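(* Suppose the topology of the network is a tree, and assume that none of the transfer functions $G^0_{ij}$ corresponding to the edges $(j,i)$ of the tree is zero. Then, for the network matrix $G^0$ to be identifiable from the measured nodes, it is necessary and sufficient to measure all the sinks.
   Context: Network. There are $L$ nodes with signals $w(t)=[w_1(t),\dots,w_L(t)]^T$ obeying $w(t)=G^0(q)w(t)+r(t)+v(t)$, where $q^{-1}$ is the delay operator, $r(t)$ is a vector of known external excitation signals (one at each node), $v(t)$ is a noise vector, and the network matrix $G^0$ is an $L\times L$ matrix with zero diagonal whose entries are proper rational transfer functions; the network is well-posed ($(I-G^0)^{-1}$ is proper and stable). $T^0=(I-G^0)^{-1}$. Topology. The topology is a known weakly connected directed graph on $\{1,\dots,L\}$ without self-loops; an edge $(j,i)$ from $j$ to $i$ corresponds to a transfer function $G_{ij}$ that is not known to be zero. A matrix $M$ is consistent with the graph if $M_{ij}\neq 0$ only if $(j,i)$ is an edge. $G^0$ is consistent with its graph. A directed graph is weakly connected if for any partition of its vertices in two sets there is at least one edge starting in one of the sets and ending in the other. A walk is a sequence of adjacent directed edges; a loop is a walk whose terminal node coincides with its initial node (usually called a cycle). A tree is a graph that is weakly connected and has no loops even if one were to change the edge directions. A sink is a node with only incoming edges (no outgoing edge). Measurements and identifiability. $y(t)=Cw(t)$, where $C$ is a $p\times L$ matrix each row of which has one entry $1$ and all others $0$; the measured nodes are those selected by $C$. The matrix $CT^0$ is assumed exactly known. The network matrix $G^0$ is identifiable from the measurements $C$ if it is the unique solution $G$, among transfer matrices consistent with the topology, of $CT^0(I-G)=C$.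 *)

theory Defs
  imports
    "HOL-Analysis.Analysis"
    "HOL-Computational_Algebra.Computational_Algebra"
begin

text \<open>
  Transfer functions are real rational functions of the forward shift operator \<open>q\<close>
  (discrete time), so a proper one is bounded at \<open>q = \<infinity>\<close> and a stable one has all its
  poles in the open unit disc.  Asking for some fraction with these properties is the same as
  asking for it of the fraction in lowest terms.
\<close>

type_synonym ratfun = "real poly fract"

definition proper_rat :: "ratfun \<Rightarrow> bool" where
  "proper_rat f \<longleftrightarrow>
     (\<exists>a b. b \<noteq> 0 \<and> f = Fraction_Field.Fract a b \<and> degree a \<le> degree b)"

definition stable_rat :: "ratfun \<Rightarrow> bool" where
  "stable_rat f \<longleftrightarrow>
     (\<exists>a b. b \<noteq> 0 \<and> f = Fraction_Field.Fract a b \<and>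
        (\<forall>z::complex. poly (map_poly of_real b) z = 0 \<longrightarrow> cmod z < 1))"

definition transfer_matrix :: "ratfun ^ 'n ^ 'm \<Rightarrow> bool" where
  "transfer_matrix M \<longleftrightarrow> (\<forall>i j. proper_rat (M $ i $ j))"

definition stable_matrix :: "ratfun ^ 'n ^ 'm \<Rightarrow> bool" where
  "stable_matrix M \<longleftrightarrow> (\<forall>i j. stable_rat (M $ i $ j))"

text \<open>
  The nodes are the elements of a finite type and a directed graph is its set of edges, where
  \<open>(j, i)\<close> is the edge from \<open>j\<close> to \<open>i\<close>.
\<close>

definition weakly_connected :: "('n \<times> 'n) set \<Rightarrow> bool" where
  "weakly_connected E \<longleftrightarrow>
     (\<forall>S. S \<noteq> {} \<and> S \<noteq> UNIV \<longrightarrow>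
        (\<exists>(a, b) \<in> E. (a \<in> S \<and> b \<notin> S) \<or> (a \<notin> S \<and> b \<in> S)))"

text \<open>
  Below, \<open>F\<close> is the set of edges whose direction is changed.  Taking \<open>F = {}\<close> shows
  that a tree has no pair of opposite edges, so no reversed edge ever coincides with a kept one.
\<close>

definition is_tree :: "('n \<times> 'n) set \<Rightarrow> bool" where
  "is_tree E \<longleftrightarrow> weakly_connected E \<and> (\<forall>F \<subseteq> E. acyclic ((E - F) \<union> F\<inverse>))"

definition sink :: "('n \<times> 'n) set \<Rightarrow> 'n \<Rightarrow> bool" where
  "sink E i \<longleftrightarrow> (\<forall>k. (i, k) \<notin> E)"

definition consistent :: "('n \<times> 'n) set \<Rightarrow> ratfun ^ 'n ^ 'n \<Rightarrow> bool" where
  "consistent E M \<longleftrightarrow> (\<forall>i j. M $ i $ j \<noteq> 0 \<longrightarrow> (j, i) \<in> E)"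

definition closed_loop :: "ratfun ^ 'n ^ 'n \<Rightarrow> ratfun ^ 'n ^ 'n" where
  "closed_loop G = matrix_inv (mat 1 - G)"

definition well_posed :: "ratfun ^ 'n ^ 'n \<Rightarrow> bool" where
  "well_posed G \<longleftrightarrow> invertible (mat 1 - G) \<and>
     transfer_matrix (closed_loop G) \<and> stable_matrix (closed_loop G)"

definition network_matrix :: "('n \<times> 'n) set \<Rightarrow> ratfun ^ 'n ^ 'n \<Rightarrow> bool" where
  "network_matrix E G \<longleftrightarrow>
     (\<forall>i. G $ i $ i = 0) \<and> transfer_matrix G \<and> consistent E G \<and> well_posed G"

definition selection_matrix :: "ratfun ^ 'n ^ 'p \<Rightarrow> bool" where
  "selection_matrix C \<longleftrightarrow>
     (\<forall>k. \<exists>i. C $ k $ i = 1 \<and> (\<forall>j. j \<noteq> i \<longrightarrow> C $ k $ j = 0))"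

definition measured :: "ratfun ^ 'n ^ 'p \<Rightarrow> 'n \<Rightarrow> bool" where
  "measured C i \<longleftrightarrow> (\<exists>k. C $ k $ i = 1)"

definition identifiable ::
  "('n \<times> 'n) set \<Rightarrow> ratfun ^ 'n ^ 'p \<Rightarrow> ratfun ^ 'n ^ 'n \<Rightarrow> bool" where
  "identifiable E C G0 \<longleftrightarrow>
     {G. transfer_matrix G \<and> consistent E G \<and> C ** closed_loop G0 ** (mat 1 - G) = C} = {G0}"

end

theory Submission imports Defs begin

text \<open>
  Put \<open>T = closed_loop G0\<close> and \<open>D = G - G0\<close>.  Since \<open>T (I - G0) = I\<close>, the matrix
  \<open>G\<close> solves \<open>C T (I - G) = C\<close> iff the rows of \<open>T D\<close> that belong to measured nodes vanish.
  The recursion \<open>T = I + T G0\<close> along the edges of the tree shows that \<open>T\<^sub>c\<^sub>i \<noteq> 0\<close> exactly when there is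
  a walk from \<open>i\<close> to \<open>c\<close>: in a tree at most one out-neighbour of \<open>i\<close> leads to \<open>c\<close>, so no cancellation
  occurs.  If all sinks are measured and \<open>(j, i)\<close> is an edge, choose a sink \<open>s\<close> reachable from \<open>i\<close>;
  the equation \<open>(T D)\<^sub>s\<^sub>j = 0\<close> then reduces to \<open>T\<^sub>s\<^sub>i D\<^sub>i\<^sub>j = 0\<close>.  Conversely, the
  transfer functions into an unmeasured sink can be changed at will, because column \<open>s\<close> of \<open>T\<close>
  is the unit vector at \<open>s\<close>.
\<close>

section \<open>Walks in trees\<close>

lemma is_tree_acyclic: "is_tree E \<Longrightarrow> acyclic E"
  unfolding is_tree_def by (metis Diff_empty Un_empty_right converse_empty empty_subsetI)

lemma is_tree_unique_out_neighbour:
  assumes tree: "is_tree E"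
    and e: "(j, k) \<in> E" "(j, k') \<in> E"
    and r: "(k, c) \<in> E\<^sup>*" "(k', c) \<in> E\<^sup>*"
  shows "k = k'"
proof (rule ccontr)
  assume ne: "k \<noteq> k'"
  have ac: "(j, j) \<notin> E\<^sup>+"
    using is_tree_acyclic[OF tree] by (simp add: acyclic_def)
  define R where "R = {x. (k, x) \<in> E\<^sup>*}"
  \<comment> \<open>Reversing the edges that start outside \<open>R\<close>, except \<open>(j, k)\<close>, produces the cycle
      \<open>j, k, \<dots>, m, \<dots>, k', j\<close>, where \<open>m\<close> is the first node of \<open>R\<close> on the walk from \<open>k'\<close> to \<open>c\<close>.\<close>
  define F where "F = {(a, b) \<in> E. a \<notin> R \<and> (a, b) \<noteq> (j, k)}"
  define H where "H = (E - F) \<union> F\<inverse>"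
  have jR: "j \<notin> R"
    using ac e(1) unfolding R_def by (metis mem_Collect_eq rtrancl_into_trancl2)
  \<comment> \<open>Every edge on a walk from \<open>k\<close> starts in \<open>R\<close>, so none
    of them is reversed.\<close>
  have fwd: "(k, x) \<in> H\<^sup>*" if "(k, x) \<in> E\<^sup>*" for x
    using that
  proof (induction rule: rtrancl_induct)
    case (step y z)
    then have "(y, z) \<in> H" by (auto simp: H_def F_def R_def)
    with step.IH show ?case by (rule rtrancl_into_rtrancl)
  qed simp
  \<comment> \<open>Since \<open>x\<close> does not reach \<open>j\<close>, the walk to
    \<open>c\<close> never uses the exempt edge \<open>(j, k)\<close>; all its edges before it
    enters \<open>R\<close> are therefore reversed.\<close>
  have bwd: "\<exists>m\<in>R. (m, x) \<in> H\<^sup>*" if "(x, c) \<in> E\<^sup>*" "(x, j) \<notin> E\<^sup>*" for x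
    using that
  proof (induction rule: converse_rtrancl_induct)
    case base
    then show ?case using r(1) by (auto simp: R_def)
  next
    case (step x y)
    show ?case
    proof (cases "x \<in> R")
      case False
      have "x \<noteq> j" using step.prems by auto
      then have "(y, x) \<in> H" using step.hyps(1) False by (auto simp: H_def F_def)
      moreover have "(y, j) \<notin> E\<^sup>*"
        using step.hyps(1) step.prems by (meson converse_rtrancl_into_rtrancl)
      ultimately show ?thesis using step.IH by (meson rtrancl_into_rtrancl)
    qed auto
  qed
  have "(k', j) \<notin> E\<^sup>*" using ac e(2) by (meson rtrancl_into_trancl2)
  then obtain m where m: "m \<in> R" "(m, k') \<in> H\<^sup>*" using bwd r(2) by blast
  have "(j, k) \<in> H" using e(1) by (auto simp: H_def F_def)
  moreover have "(k, k') \<in> H\<^sup>*" using fwd[of m] m by (auto simp: R_def)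
  moreover have "(k', j) \<in> H" using e(2) jR ne by (auto simp: H_def F_def)
  ultimately have "(j, j) \<in> H\<^sup>+"
    by (meson rtrancl_into_trancl1 rtrancl_into_trancl2 trancl_into_rtrancl)
  moreover have "F \<subseteq> E" by (auto simp: F_def)
  then have "acyclic H" using tree unfolding is_tree_def H_def by blast
  ultimately show False by (simp add: acyclic_def)
qed

text \<open>Supplies the induction that treats a node after all its out-neighbours.\<close>

lemma acyclic_wf_converse:
  fixes E :: "('n::finite \<times> 'n) set"
  assumes "acyclic E"
  shows "wf (E\<inverse>)"
  using assms by (simp add: finite_acyclic_wf_converse)

lemma acyclic_reaches_sink:
  fixes E :: "('n::finite \<times> 'n) set"
  assumes "acyclic E"
  shows "\<exists>s. sink E s \<and> (i, s) \<in> E\<^sup>*"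
  using acyclic_wf_converse[OF assms]
proof (induction i rule: wf_induct_rule)
  case (less i)
  show ?case
  proof (cases "sink E i")
    case False
    then obtain k where "(i, k) \<in> E" unfolding sink_def by blast
    with less[of k] show ?thesis by (auto intro: converse_rtrancl_into_rtrancl)
  qed auto
qed

section \<open>Properness and matrix algebra\<close>

lemma proper_rat_add:
  assumes "proper_rat f" "proper_rat g"
  shows "proper_rat (f + g)"
proof -
  obtain a b where f: "b \<noteq> 0" "f = Fract a b" "degree a \<le> degree b"
    using assms(1) unfolding proper_rat_def by blast
  obtain c d where g: "d \<noteq> 0" "g = Fract c d" "degree c \<le> degree d"
    using assms(2) unfolding proper_rat_def by blast
  have "degree (a * d) \<le> degree (b * d)" "degree (c * b) \<le> degree (b * d)"
    using f g degree_mult_le[of a d] degree_mult_le[of c b] by (simp_all add: degree_mult_eq)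
  then have "degree (a * d + c * b) \<le> degree (b * d)"
    by (rule degree_add_le)
  then show ?thesis
    unfolding proper_rat_def using f g
    by (intro exI[of _ "a * d + c * b"] exI[of _ "b * d"]) simp
qed

lemma proper_rat_0: "proper_rat 0"
  unfolding proper_rat_def by (intro exI[of _ 0] exI[of _ 1]) (simp add: Zero_fract_def)

lemma proper_rat_1: "proper_rat 1"
  unfolding proper_rat_def by (intro exI[of _ 1] exI[of _ 1]) (simp add: One_fract_def)

lemma matrix_diff_ldistrib:
  fixes A :: "'a::ring_1 ^ 'n::finite ^ 'm" and B B' :: "'a ^ 'k ^ 'n"
  shows "A ** (B - B') = A ** B - A ** B'"
  by (simp add: matrix_matrix_mult_def vec_eq_iff right_diff_distrib sum_subtractf)

section \<open>Zero pattern of the closed loop\<close>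

lemma closed_loop_left_inverse:
  assumes "well_posed G"
  shows "closed_loop G ** (mat 1 - G) = mat 1"
  using assms unfolding well_posed_def closed_loop_def matrix_inv_def invertible_def
  by (metis (mono_tags, lifting) someI_ex)

text \<open>This is \<open>T = I + T G\<close> entrywise. With \<open>G\<close> on the right, the
  row \<open>c\<close> stays fixed and, for consistent \<open>G\<close>, only out-neighbours
  \<open>k\<close> of \<open>i\<close> contribute.\<close>

lemma closed_loop_rec:
  assumes "well_posed G"
  shows "closed_loop G $ c $ i =
    (if c = i then 1 else 0) + (\<Sum>k\<in>UNIV. closed_loop G $ c $ k * G $ k $ i)"
proof -
  have "closed_loop G - closed_loop G ** G = mat 1"
    using closed_loop_left_inverse[OF assms] by (simp add: matrix_diff_ldistrib)
  then have "(closed_loop G - closed_loop G ** G) $ c $ i = (mat 1 :: ratfun ^ 'a ^ 'a) $ c $ i"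
    by simp
  then show ?thesis
    by (simp add: matrix_matrix_mult_def mat_def algebra_simps split: if_splits)
qed

text \<open>If \<open>i\<close> cannot reach \<open>c\<close>, neither can its out-neighbours, so
  every term of the recursion vanishes.\<close>

lemma closed_loop_zero_if_unreachable:
  fixes E :: "('n::finite \<times> 'n) set"
  assumes "acyclic E" "well_posed G" "consistent E G" "(i, c) \<notin> E\<^sup>*"
  shows "closed_loop G $ c $ i = 0"
  using acyclic_wf_converse[OF assms(1)] assms(4)
proof (induction i rule: wf_induct_rule)
  case (less i)
  have "closed_loop G $ c $ k * G $ k $ i = 0" for k
  proof (cases "(i, k) \<in> E")
    case True
    then show ?thesis
      using less by (simp add: converse_rtrancl_into_rtrancl) (meson converse_rtrancl_into_rtrancl)
  next
    case False
    then show ?thesis using assms(3) unfolding consistent_def by auto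
  qed
  then have "(\<Sum>k\<in>UNIV. closed_loop G $ c $ k * G $ k $ i) = 0" by (intro sum.neutral) blast
  moreover have "c \<noteq> i" using less.prems by auto
  ultimately show ?case using closed_loop_rec[OF assms(2), of c i] by simp
qed

lemma closed_loop_nonzero_if_reachable:
  fixes E :: "('n::finite \<times> 'n) set"
  assumes tree: "is_tree E" and wp: "well_posed G" and con: "consistent E G"
    and nz: "\<forall>(j, i) \<in> E. G $ i $ j \<noteq> 0"
    and "(i, c) \<in> E\<^sup>*"
  shows "closed_loop G $ c $ i \<noteq> 0"
  using assms(5)
proof (induction rule: converse_rtrancl_induct)
  note ac = is_tree_acyclic[OF tree]
  note zero = closed_loop_zero_if_unreachable[OF ac wp con]
  case base
  have "closed_loop G $ c $ k * G $ k $ c = 0" for k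
  proof (cases "(c, k) \<in> E")
    case True
    \<comment> \<open>A walk back to \<open>c\<close> would close a cycle; hence the diagonal entry
      is 1.\<close>
    then have "(k, c) \<notin> E\<^sup>*" using ac by (meson acyclic_def rtrancl_into_trancl2)
    then show ?thesis by (simp add: zero)
  next
    case False
    then show ?thesis using con unfolding consistent_def by auto
  qed
  then have "(\<Sum>k\<in>UNIV. closed_loop G $ c $ k * G $ k $ c) = 0" by (intro sum.neutral) blast
  then show ?case using closed_loop_rec[OF wp, of c c] by simp
next
  note ac = is_tree_acyclic[OF tree]
  note zero = closed_loop_zero_if_unreachable[OF ac wp con]
  case (step i k)
  \<comment> \<open>Only the next node \<open>k\<close> of the walk contributes, so the entry is a
    product of two nonzero factors.\<close>
  have "closed_loop G $ c $ l * G $ l $ i = 0" if "l \<noteq> k" for l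
  proof (cases "(i, l) \<in> E")
    case True
    then have "(l, c) \<notin> E\<^sup>*"
      using is_tree_unique_out_neighbour[OF tree step.hyps(1) True step.hyps(2)] that by blast
    then show ?thesis by (simp add: zero)
  next
    case False
    then show ?thesis using con unfolding consistent_def by auto
  qed
  then have "(\<Sum>l\<in>UNIV. closed_loop G $ c $ l * G $ l $ i)
      = (\<Sum>l\<in>{k}. closed_loop G $ c $ l * G $ l $ i)"
    by (intro sum.mono_neutral_right) auto
  moreover have "c \<noteq> i"
    using ac step.hyps by (metis acyclic_def rtrancl_into_trancl2)
  moreover have "G $ k $ i \<noteq> 0" using nz step.hyps(1) by blast
  ultimately show ?case
    using closed_loop_rec[OF wp, of c i] step.IH by simp
qed

section \<open>Reduction of the identifiability equation\<close>

lemma selection_matrix_mult_eq_0_iff: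
  fixes C :: "ratfun ^ 'n::finite ^ 'p::finite" and M :: "ratfun ^ 'm ^ 'n"
  assumes "selection_matrix C"
  shows "C ** M = 0 \<longleftrightarrow> (\<forall>i. measured C i \<longrightarrow> (\<forall>j. M $ i $ j = 0))"
proof -
  \<comment> \<open>Each row of \<open>C\<close> is a unit vector and thus picks out one row of
    \<open>M\<close>.\<close>
  have row: "(C ** M) $ k $ j = M $ i $ j" if "C $ k $ i = 1" for k i j
  proof -
    have "C $ k $ l = 0" if "l \<noteq> i" for l
      using assms \<open>C $ k $ i = 1\<close> that unfolding selection_matrix_def by (metis zero_neq_one)
    then have "(C ** M) $ k $ j = (\<Sum>l\<in>{i}. C $ k $ l * M $ l $ j)"
      unfolding matrix_matrix_mult_def vec_lambda_beta
      by (intro sum.mono_neutral_right) auto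
    then show ?thesis using that by simp
  qed
  have ex: "\<exists>i. C $ k $ i = 1" for k
    using assms unfolding selection_matrix_def by blast
  show ?thesis
    unfolding vec_eq_iff measured_def using row ex by (metis zero_index)
qed

lemma identifiability_equation_iff:
  fixes C :: "ratfun ^ 'n::finite ^ 'p::finite"
  assumes "selection_matrix C" "well_posed G0"
  shows "C ** closed_loop G0 ** (mat 1 - G) = C \<longleftrightarrow>
    (\<forall>i. measured C i \<longrightarrow> (\<forall>j. (closed_loop G0 ** (G - G0)) $ i $ j = 0))"
proof -
  have "mat 1 - G = (mat 1 - G0) - (G - G0)" by simp
  then have "C ** closed_loop G0 ** (mat 1 - G) = C - C ** (closed_loop G0 ** (G - G0))"
    using closed_loop_left_inverse[OF assms(2)]
    by (metis matrix_mul_assoc matrix_mul_rid matrix_diff_ldistrib)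
  then have "C ** closed_loop G0 ** (mat 1 - G) = C \<longleftrightarrow> C ** (closed_loop G0 ** (G - G0)) = 0"
    by simp
  then show ?thesis
    using selection_matrix_mult_eq_0_iff[OF assms(1)] by metis
qed

section \<open>Sufficiency\<close>

lemma identifiable_if_sinks_measured:
  fixes E :: "('n::finite \<times> 'n) set" and C :: "ratfun ^ 'n ^ 'p::finite"
  assumes net: "network_matrix E G0" and C: "selection_matrix C" and tree: "is_tree E"
    and nz: "\<forall>(j, i) \<in> E. G0 $ i $ j \<noteq> 0"
    and sinks: "\<forall>i. sink E i \<longrightarrow> measured C i"
  shows "identifiable E C G0"
proof -
  have wp: "well_posed G0" and con: "consistent E G0" and tm: "transfer_matrix G0"
    using net unfolding network_matrix_def by auto
  note ac = is_tree_acyclic[OF tree]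
  have "G = G0" if G: "consistent E G" and eq: "C ** closed_loop G0 ** (mat 1 - G) = C" for G
  proof -
    have "G $ i $ j = G0 $ i $ j" for i j
    proof (cases "(j, i) \<in> E")
      case False
      then show ?thesis using G con unfolding consistent_def by metis
    next
      case True
      obtain s where s: "sink E s" "(i, s) \<in> E\<^sup>*" using acyclic_reaches_sink[OF ac] by blast
      \<comment> \<open>As \<open>i\<close> already leads from \<open>j\<close> to \<open>s\<close>,
        no other out-neighbour of \<open>j\<close> does.\<close>
      have "closed_loop G0 $ s $ k * (G - G0) $ k $ j = 0" if "k \<noteq> i" for k
      proof (cases "(j, k) \<in> E")
        case jk: True
        have "(k, s) \<notin> E\<^sup>*"
          using is_tree_unique_out_neighbour[OF tree True jk s(2)] that by blast
        then show ?thesis by (simp add: closed_loop_zero_if_unreachable[OF ac wp con])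
      next
        case False
        then have "G $ k $ j = 0" "G0 $ k $ j = 0"
          using G con unfolding consistent_def by blast+
        then show ?thesis by simp
      qed
      then have "(closed_loop G0 ** (G - G0)) $ s $ j
          = (\<Sum>k\<in>{i}. closed_loop G0 $ s $ k * (G - G0) $ k $ j)"
        unfolding matrix_matrix_mult_def vec_lambda_beta
        by (intro sum.mono_neutral_right) auto
      moreover have "(closed_loop G0 ** (G - G0)) $ s $ j = 0"
        using eq sinks s(1) by (simp add: identifiability_equation_iff[OF C wp])
      moreover have "closed_loop G0 $ s $ i \<noteq> 0"
        by (rule closed_loop_nonzero_if_reachable[OF tree wp con nz s(2)])
      ultimately show ?thesis by simp
    qed
    then show ?thesis by (simp add: vec_eq_iff)
  qed
  moreover have "C ** closed_loop G0 ** (mat 1 - G0) = C"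
    by (metis closed_loop_left_inverse[OF wp] matrix_mul_assoc matrix_mul_rid)
  ultimately show ?thesis
    unfolding identifiable_def using tm con by auto
qed

section \<open>Necessity\<close>

lemma sink_measured_if_identifiable:
  fixes E :: "('n::finite \<times> 'n) set" and C :: "ratfun ^ 'n ^ 'p::finite"
  assumes net: "network_matrix E G0" and C: "selection_matrix C" and wc: "weakly_connected E"
    and ident: "identifiable E C G0" and s: "sink E s"
  shows "measured C s"
proof (rule ccontr)
  assume ns: "\<not> measured C s"
  have wp: "well_posed G0" and con: "consistent E G0" and tm: "transfer_matrix G0"
    using net unfolding network_matrix_def by auto
  \<comment> \<open>Index types are nonempty, so \<open>C\<close> has a row and some node other than
    \<open>s\<close> exists; weak connectivity then gives an edge into \<open>s\<close>.\<close>
  obtain c where "measured C c"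
    using C unfolding selection_matrix_def measured_def by blast
  then have "c \<notin> {s}" using ns by blast
  then have "{s} \<noteq> UNIV" by (metis UNIV_I)
  then obtain a b where "(a, b) \<in> E" "(a \<in> {s} \<and> b \<notin> {s}) \<or> (a \<notin> {s} \<and> b \<in> {s})"
    using wc[unfolded weakly_connected_def, rule_format, of "{s}"] by blast
  then have as: "(a, s) \<in> E" using s unfolding sink_def by auto
  \<comment> \<open>\<open>D\<close> perturbs the single entry of the edge \<open>(a, s)\<close>.
    Then \<open>closed_loop G0 ** D\<close> involves only column \<open>s\<close> of the closed
    loop, which is zero in all measured rows.\<close>
  define D :: "ratfun ^ 'n ^ 'n" where "D = (\<chi> i j. if i = s \<and> j = a then 1 else 0)"
  have "G0 $ k $ s = 0" for k
    using con s unfolding consistent_def sink_def by blast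
  then have col: "closed_loop G0 $ c $ s = 0" if "c \<noteq> s" for c
    using closed_loop_rec[OF wp, of c s] that by simp
  have "(closed_loop G0 ** D) $ c $ j = 0" if "measured C c" for c j
  proof -
    have "closed_loop G0 $ c $ k * D $ k $ j = 0" for k
      using col[of c] that ns by (auto simp: D_def)
    then show ?thesis
      unfolding matrix_matrix_mult_def vec_lambda_beta by (intro sum.neutral) blast
  qed
  then have "C ** closed_loop G0 ** (mat 1 - (G0 + D)) = C"
    by (simp add: identifiability_equation_iff[OF C wp])
  moreover have "consistent E (G0 + D)"
    using con as by (auto simp: consistent_def D_def split: if_splits)
  moreover have "transfer_matrix (G0 + D)"
    using tm by (auto simp: transfer_matrix_def D_def proper_rat_add proper_rat_0 proper_rat_1)
  ultimately have "G0 + D = G0"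
    using ident unfolding identifiable_def by blast
  then have "D $ s $ a = 0" by simp
  then show False by (simp add: D_def)
qed

theorem mainTheorem5:
  fixes E :: "('n::finite \<times> 'n) set"
    and G0 :: "ratfun ^ 'n ^ 'n"
    and C :: "ratfun ^ 'n ^ 'p::finite"
  assumes "irrefl E"
    and "network_matrix E G0"
    and "selection_matrix C"
    and "is_tree E"
    and "\<forall>(j, i) \<in> E. G0 $ i $ j \<noteq> 0"
  shows "identifiable E C G0 \<longleftrightarrow> (\<forall>i. sink E i \<longrightarrow> measured C i)"
proof
  assume "identifiable E C G0"
  then show "\<forall>i. sink E i \<longrightarrow> measured C i"
    using sink_measured_if_identifiable assms(2-4) unfolding is_tree_def by blast
next
  assume "\<forall>i. sink E i \<longrightarrow> measured C i"
  then show "identifiable E C G0"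
    by (rule identifiable_if_sinks_measured[OF assms(2-5)])
qed

end
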